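(* Let $W\times T\subset\mathbb{R}^2\times\mathbb{R}$ be a bounded non-empty open set and assume: (i) $\{Y_i\}_{i\ge1}$ and $\{E_i\}_{i\ge1}$ are two independent sequences of independent and identically distributed point processes on $W\times T$, defined on the same underlying probability space; $X_n=\bigcup_{i=1}^nY_i$ and $D_n=\bigcup_{i=1}^nE_i$. (ii) Each $Y_i$ is a Poisson point process with intensity function $\lambda(u;\boldsymbol\theta)=b(u)\exp(\boldsymbol\theta^\top\boldsymbol z(u))$, where $b:W\times T\to(0,\infty)$ is absolutely integrable, $\boldsymbol z=[z^{(1)},\dots,z^{(m)}]^\top:W\times T\to\mathbb{R}^m$ is measurable, and $\boldsymbol\theta$ lies in an open set $\boldsymbol\Theta\subset\mathbb{R}^m$; each $E_i$ has an absolutely integrable intensity function $\rho(u)>0$. (iii) For every $\boldsymbol\theta\in\boldsymbol\Theta$ there exist $\epsilon_1(\boldsymbol\theta),\epsilon_2(\boldsymbol\theta)>0$ with $\epsilon_1(\boldsymbol\theta)<\inf_{u\in W\times T}\rho(u)/\lambda(u;\boldsymbol\theta)$ and $\sup_{u\in W\times T}\rho(u)/\lambda(u;\boldsymbol\theta)<\epsilon_2(\boldsymbol\theta)$. (iv) $\sup_{u\in W\times T}\|\boldsymbol z(u)\|<\infty$. (v) $\boldsymbol\Theta$ is convex. (vi) For $\boldsymbol\theta,\tilde{\boldsymbol\theta}\in\boldsymbol\Theta$, if $\lambda(u;\boldsymbol\theta)=\lambda(u;\tilde{\boldsymbol\theta})$ for almost every $u\in W\times T$, then $\boldsymbol\theta=\tilde{\boldsymbol\theta}$.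 Let $\boldsymbol\theta_0\in\boldsymbol\Theta$ be the true parameter value, and for $\boldsymbol\theta\in\boldsymbol\Theta$ define $$l_n(\boldsymbol\theta)=\sum_{x\in X_n}\log\left[\frac{\lambda(x;\boldsymbol\theta)}{\lambda(x;\boldsymbol\theta)+\rho(x)}\right]+\sum_{x\in D_n}\log\left[\frac{\rho(x)}{\lambda(x;\boldsymbol\theta)+\rho(x)}\right].$$ Set $\widehat{\boldsymbol\theta}_n=\arg\max_{\boldsymbol\theta\in\boldsymbol\Theta}l_n(\boldsymbol\theta)$. If $\widehat{\boldsymbol\theta}_n$ is attained (that is, the maximum is achieved at a point of $\boldsymbol\Theta$), then, as $n\to\infty$, $\widehat{\boldsymbol\theta}_n$ converges $P_{\boldsymbol\theta_0}$-almost surely to $\boldsymbol\theta_0$.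
   Context: A point process $Z$ on $W\times T$ has intensity function $\kappa:W\times T\to[0,\infty)$ if $\mathbb{E}\{\sum_{x\in Z}1(x\in B)\}=\int_B\kappa(u)\,du$ for every Borel set $B\subset W\times T$. A Poisson point process with intensity function $\kappa$ is one for which the number of points in each Borel $B$ is Poisson distributed with mean $\int_B\kappa(u)\,du$ and numbers of points in disjoint Borel sets are independent. Unions of point processes are superpositions, so $\sum_{x\in X_n}=\sum_{i=1}^n\sum_{x\in Y_i}$ and likewise for $D_n$. $P_{\boldsymbol\theta_0}$ denotes the probability distribution under the true parameter value $\boldsymbol\theta_0$, i.e. when each $Y_i$ has intensity function $\lambda(\cdot;\boldsymbol\theta_0)$; the law of the $E_i$ does not depend on $\boldsymbol\theta$. *)

theory Defs
  imports "HOL-Probability.Probability"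
begin

text \<open>
  Point configurations on a bounded region \<open>S\<close> are finite multisets of points of \<open>S\<close>:
  local finiteness on a bounded \<open>S\<close> is finiteness, and multiplicities make the superposition
  of point processes the sum of multisets.
\<close>

definition npoints :: "'a multiset \<Rightarrow> 'a set \<Rightarrow> nat" where
  "npoints c B = size (filter_mset (\<lambda>x. x \<in> B) c)"

text \<open>The \<open>\<sigma>\<close>-algebra is the smallest one that makes all counts of points in Borel sets measurable.\<close>

definition configs :: "'a::topological_space set \<Rightarrow> 'a multiset measure" where
  "configs S = sigma {c. set_mset c \<subseteq> S}
     {{c. set_mset c \<subseteq> S \<and> npoints c B = k} | B k. B \<in> sets borel \<and> B \<subseteq> S}"

definition point_process ::
    "'w measure \<Rightarrow> 'a::topological_space set \<Rightarrow> ('w \<Rightarrow> 'a multiset) \<Rightarrow> bool" where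
  "point_process P S Z \<longleftrightarrow> Z \<in> measurable P (configs S)"

definition has_intensity ::
    "'w measure \<Rightarrow> 'a::euclidean_space set \<Rightarrow> ('w \<Rightarrow> 'a multiset) \<Rightarrow> ('a \<Rightarrow> real) \<Rightarrow> bool" where
  "has_intensity P S Z \<kappa> \<longleftrightarrow>
     point_process P S Z \<and>
     \<kappa> \<in> borel_measurable (restrict_space borel S) \<and> (\<forall>u\<in>S. 0 \<le> \<kappa> u) \<and>
     (\<forall>B\<in>sets borel. B \<subseteq> S \<longrightarrow>
        (\<integral>\<^sup>+\<omega>. of_nat (npoints (Z \<omega>) B) \<partial>P) = (\<integral>\<^sup>+u\<in>B. ennreal (\<kappa> u) \<partial>lborel))"

text \<open>
  Finite configurations force a Poisson process to have finite mean total count, hence the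
  integrability requirement.  The Poisson probabilities are written out because the mean may be 0,
  which \<open>poisson_pmf\<close> excludes.  Finite families of disjoint sets are covered by padding them
  with empty sets.
\<close>

definition poisson_process ::
    "'w measure \<Rightarrow> 'a::euclidean_space set \<Rightarrow> ('w \<Rightarrow> 'a multiset) \<Rightarrow> ('a \<Rightarrow> real) \<Rightarrow> bool" where
  "poisson_process P S Z \<kappa> \<longleftrightarrow>
     point_process P S Z \<and>
     set_integrable lborel S \<kappa> \<and> (\<forall>u\<in>S. 0 \<le> \<kappa> u) \<and>
     (\<forall>B\<in>sets borel. B \<subseteq> S \<longrightarrow>
        (\<forall>k. measure P {\<omega> \<in> space P. npoints (Z \<omega>) B = k} =
             (LINT u:B|lborel. \<kappa> u) ^ k / fact k * exp (- (LINT u:B|lborel. \<kappa> u)))) \<and>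
     (\<forall>B :: nat \<Rightarrow> 'a set. (\<forall>i. B i \<in> sets borel \<and> B i \<subseteq> S) \<longrightarrow> disjoint_family B \<longrightarrow>
        prob_space.indep_vars P (\<lambda>_. count_space UNIV) (\<lambda>i \<omega>. npoints (Z \<omega>) (B i)) UNIV)"

definition iid_sequence :: "'w measure \<Rightarrow> 'c measure \<Rightarrow> (nat \<Rightarrow> 'w \<Rightarrow> 'c) \<Rightarrow> bool" where
  "iid_sequence P N X \<longleftrightarrow>
     prob_space.indep_vars P (\<lambda>_. N) X UNIV \<and> (\<forall>i j. distr P N (X i) = distr P N (X j))"

definition indep_sequences ::
    "'w measure \<Rightarrow> 'c measure \<Rightarrow> (nat \<Rightarrow> 'w \<Rightarrow> 'c) \<Rightarrow> (nat \<Rightarrow> 'w \<Rightarrow> 'c) \<Rightarrow> bool" where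
  "indep_sequences P N X Y \<longleftrightarrow>
     prob_space.indep_var P (Pi\<^sub>M UNIV (\<lambda>_. N)) (\<lambda>\<omega> i. X i \<omega>) (Pi\<^sub>M UNIV (\<lambda>_. N)) (\<lambda>\<omega> i. Y i \<omega>)"

text \<open>Sequences of processes are indexed from 0, so this superposes the first \<open>n\<close> of them.\<close>

definition superposition :: "(nat \<Rightarrow> 'w \<Rightarrow> 'a multiset) \<Rightarrow> nat \<Rightarrow> 'w \<Rightarrow> 'a multiset" where
  "superposition Z n \<omega> = (\<Sum>i<n. Z i \<omega>)"

definition loglinear_intensity ::
    "('a \<Rightarrow> real) \<Rightarrow> ('a \<Rightarrow> real^'m) \<Rightarrow> real^'m \<Rightarrow> 'a \<Rightarrow> real" where
  "loglinear_intensity b z \<theta> u = b u * exp (\<theta> \<bullet> z u)"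

definition logistic_loglik ::
    "(real^'m \<Rightarrow> 'a \<Rightarrow> real) \<Rightarrow> ('a \<Rightarrow> real) \<Rightarrow> 'a multiset \<Rightarrow> 'a multiset \<Rightarrow> real^'m \<Rightarrow> real" where
  "logistic_loglik lam \<rho> X D \<theta> =
     (\<Sum>x\<in>#X. ln (lam \<theta> x / (lam \<theta> x + \<rho> x))) + (\<Sum>x\<in>#D. ln (\<rho> x / (lam \<theta> x + \<rho> x)))"

end

theory Submission
  imports Defs
begin

text \<open>
  Write \<open>S = W \<times> T\<close> and call \<open>x\<close> a data point if it comes from \<open>X\<^sub>n\<close> and a dummy point if it
  comes from \<open>D\<^sub>n\<close>.  A point located at \<open>u\<close> is a data point with probability
  \<open>\<lambda>(u;\<theta>) / (\<lambda>(u;\<theta>) + \<rho>(u))\<close>, so \<open>l\<^sub>n\<close> is the log-likelihood of a logistic regression with linear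
  predictor \<open>s(\<theta>) = \<theta> \<bullet> z(u) + ln (b(u) / \<rho>(u))\<close>.  With \<open>\<phi>(t) = ln (1 + exp t)\<close>, a data point
  contributes \<open>- \<phi>(- s(\<theta>))\<close> and a dummy point \<open>- \<phi>(s(\<theta>))\<close>.  As \<open>\<phi>\<close> is convex and 1-Lipschitz,
  \<open>l\<^sub>n\<close> is concave in \<open>\<theta>\<close>, and every contribution is Lipschitz in \<open>\<theta>\<close> with constant \<open>sup \<parallel>z\<parallel>\<close>.

  \<^bold>\<open>Mean gain.\<close>  By the Campbell formula (\<open>campbell\<close>), the expectation of the sum of \<open>h\<close> over the
  points of a process is the integral of \<open>h\<close> against its intensity.  Hence the mean of the increment
  of \<open>l\<^sub>n(\<theta>) - l\<^sub>n(\<theta>\<^sub>0)\<close> contributed by one pair \<open>(Y\<^sub>i, E\<^sub>i)\<close> is minus the integral over \<open>S\<close> of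
  \<open>\<lambda>(u;\<theta>\<^sub>0) + \<rho>(u)\<close> times a Kullback-Leibler divergence between two Bernoulli laws.  It is negative
  unless \<open>\<lambda>(\<sqdot>;\<theta>) = \<lambda>(\<sqdot>;\<theta>\<^sub>0)\<close> almost everywhere (\<open>expected_gain_neg\<close>), which identifiability
  excludes for \<open>\<theta> \<noteq> \<theta>\<^sub>0\<close>.

  \<^bold>\<open>From means to samples.\<close>  Only upper bounds on sums are needed, so one half of the strong law of
  large numbers is enough: partial sums of i.i.d. integrable variables with mean less than \<open>c\<close> are
  eventually less than \<open>n c\<close> (\<open>AE_eventually_sum_less\<close>).  This follows from the fact that a random
  walk with negative drift is almost surely bounded above (\<open>AE_product_bounded_sums\<close>).

  \<^bold>\<open>From points to spheres.\<close>  The Lipschitz bound extends \<open>l\<^sub>n(\<theta>) < l\<^sub>n(\<theta>\<^sub>0)\<close> from one \<open>\<theta>\<close> to a small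
  ball, and compactness extends it to a sphere around \<open>\<theta>\<^sub>0\<close> (\<open>AE_loglik_less_on_compact\<close>).  By
  concavity, a point at which \<open>l\<^sub>n\<close> is at least \<open>l\<^sub>n(\<theta>\<^sub>0)\<close>, such as the maximiser, then lies inside
  that sphere (\<open>concave_superlevel_in_ball\<close>).  Letting the radius run through a null sequence gives
  the convergence.
\<close>

section \<open>Random walks with negative drift\<close>

text \<open>
  The maximum of the partial sums with at most \<open>n\<close> terms, the empty one included.  The recursion
  removes the first step instead of the last one, because the argument below compares a walk with
  the walk that starts one step later.
\<close>

primrec max_partial_sum :: "nat \<Rightarrow> (nat \<Rightarrow> real) \<Rightarrow> real" where
  "max_partial_sum 0 x = 0"
| "max_partial_sum (Suc n) x = max 0 (x 0 + max_partial_sum n (\<lambda>i. x (Suc i)))"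

lemma max_partial_sum_nonneg: "0 \<le> max_partial_sum n x"
  by (cases n) auto

lemma partial_sum_le_max_partial_sum: "k \<le> n \<Longrightarrow> (\<Sum>i<k. x i) \<le> max_partial_sum n x"
proof (induction n arbitrary: k x)
  case (Suc n)
  show ?case
  proof (cases k)
    case (Suc j)
    with Suc.prems have "j \<le> n" by simp
    from Suc.IH[OF this, of "\<lambda>i. x (Suc i)"] Suc show ?thesis
      by (simp add: sum.lessThan_Suc_shift del: sum.lessThan_Suc)
  qed simp
qed simp

lemma max_partial_sum_mono: "max_partial_sum n x \<le> max_partial_sum (Suc n) x"
proof (induction n arbitrary: x)
  case (Suc n)
  from Suc[of "\<lambda>i. x (Suc i)"] show ?case by auto
qed simp

lemma max_partial_sum_le_sum_abs: "max_partial_sum n x \<le> (\<Sum>i<n. \<bar>x i\<bar>)"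
proof (induction n arbitrary: x)
  case (Suc n)
  from Suc[of "\<lambda>i. x (Suc i)"] show ?case
    by (auto simp: sum.lessThan_Suc_shift simp del: sum.lessThan_Suc intro: add_nonneg_nonneg sum_nonneg)
qed simp

lemma measurable_max_partial_sum [measurable]:
  "max_partial_sum n \<in> borel_measurable (PiM UNIV (\<lambda>_. borel))"
proof (induction n)
  case (Suc n)
  note [measurable] = this
  have [measurable]: "(\<lambda>x i. x (Suc i)) \<in> PiM UNIV (\<lambda>_. borel :: real measure) \<rightarrow>\<^sub>M PiM UNIV (\<lambda>_. borel)"
    by (rule measurable_PiM_single') (auto simp: space_PiM)
  have "max_partial_sum (Suc n) = (\<lambda>x. max 0 (x 0 + max_partial_sum n (\<lambda>i. x (Suc i))))"
    by (rule ext) simp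
  also have "\<dots> \<in> borel_measurable (PiM UNIV (\<lambda>_. borel))"
    by measurable
  finally show ?case .
next
  case 0
  have "max_partial_sum 0 = (\<lambda>_. 0)" by (rule ext) simp
  thus ?case by simp
qed

text \<open>
  The bound is a natural number, so that the event is a countable union of measurable events.
\<close>

definition bounded_sums :: "(nat \<Rightarrow> real) \<Rightarrow> bool" where
  "bounded_sums x \<longleftrightarrow> (\<exists>C::nat. \<forall>n. (\<Sum>i<n. x i) \<le> real C)"

lemma bounded_sums_case_nat: "bounded_sums (case_nat s x) \<longleftrightarrow> bounded_sums x"
proof
  assume "bounded_sums (case_nat s x)"
  then obtain C :: nat where C: "\<And>n. (\<Sum>i<n. case_nat s x i) \<le> real C"
    by (auto simp: bounded_sums_def)
  have "(\<Sum>i<n. x i) \<le> real (C + nat \<lceil>\<bar>s\<bar>\<rceil>)" for n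
    using C[of "Suc n"] by (simp add: sum.lessThan_Suc_shift del: sum.lessThan_Suc) linarith
  thus "bounded_sums x" unfolding bounded_sums_def by blast
next
  assume "bounded_sums x"
  then obtain C :: nat where C: "\<And>n. (\<Sum>i<n. x i) \<le> real C"
    by (auto simp: bounded_sums_def)
  have "(\<Sum>i<n. case_nat s x i) \<le> real (C + nat \<lceil>\<bar>s\<bar>\<rceil>)" for n
  proof (cases n)
    case (Suc m)
    thus ?thesis
      using C[of m] by (simp add: sum.lessThan_Suc_shift del: sum.lessThan_Suc) linarith
  qed simp
  thus "bounded_sums (case_nat s x)" unfolding bounded_sums_def by blast
qed

lemma (in pair_sigma_finite) integrable_integral_times:
  fixes f g :: "_ \<Rightarrow> real"
  assumes f: "integrable M1 f" and g: "integrable M2 g"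
  shows "integrable (M1 \<Otimes>\<^sub>M M2) (\<lambda>(x, y). f x * g y)"
    and "(\<integral>p. (\<lambda>(x, y). f x * g y) p \<partial>(M1 \<Otimes>\<^sub>M M2)) = (\<integral>x. f x \<partial>M1) * (\<integral>y. g y \<partial>M2)"
proof -
  have [measurable]: "f \<in> borel_measurable M1" "g \<in> borel_measurable M2"
    using f g by auto
  show *: "integrable (M1 \<Otimes>\<^sub>M M2) (\<lambda>(x, y). f x * g y)"
  proof (rule Fubini_integrable)
    show "integrable M1 (\<lambda>x. \<integral>y. norm (case (x, y) of (x, y) \<Rightarrow> f x * g y) \<partial>M2)"
      using f by (simp add: abs_mult)
  qed (use g in auto)
  show "(\<integral>p. (\<lambda>(x, y). f x * g y) p \<partial>(M1 \<Otimes>\<^sub>M M2)) = (\<integral>x. f x \<partial>M1) * (\<integral>y. g y \<partial>M2)"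
    using integral_fst'[OF *] by simp
qed

text \<open>
  Let \<open>M n\<close> be the maximum of the
  first \<open>n\<close> partial sums and \<open>A\<close> the event that the partial sums are unbounded.  A step \<open>s\<close> put in
  front of the walk \<open>x\<close> changes neither \<open>A\<close> nor the law of the sequence, and it turns \<open>M n\<close> into
  \<open>max 0 (s + M n)\<close>.  Hence \<open>E (1\<^sub>A max (- M n) s) = E (1\<^sub>A M (n + 1)) - E (1\<^sub>A M n) \<ge> 0\<close>.  On \<open>A\<close>
  the maxima tend to infinity, so the left-hand side tends to \<open>E (1\<^sub>A s) = P(A) E s\<close> by dominated
  convergence, where \<open>s\<close> is independent of \<open>A\<close>.  As \<open>E s < 0\<close>, this forces \<open>P(A) = 0\<close>.
\<close>

lemma AE_product_bounded_sums:
  fixes D :: "real measure"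
  assumes "prob_space D" and D [measurable_cong]: "sets D = sets borel"
    and int: "integrable D (\<lambda>s. s)" and neg: "(\<integral>s. s \<partial>D) < 0"
  shows "AE x in PiM UNIV (\<lambda>_::nat. D). bounded_sums x"
proof -
  interpret D: prob_space D by fact
  interpret sequence_space D ..
  let ?Q = "D \<Otimes>\<^sub>M S"
  interpret Q: pair_prob_space D S ..
  define A where "A = {x \<in> space S. \<not> bounded_sums x}"
  have sets_S [measurable_cong]: "sets S = sets (PiM UNIV (\<lambda>_. borel))"
    by (intro sets_PiM_cong) (auto simp: D)
  have [measurable]: "Measurable.pred S bounded_sums"
    unfolding bounded_sums_def by measurable
  have A [measurable]: "A \<in> sets S" unfolding A_def by measurable
  have case_nat_A: "case_nat s x \<in> A \<longleftrightarrow> x \<in> A" if "s \<in> space D" "x \<in> space S" for s x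
    using that by (auto simp: A_def bounded_sums_case_nat space_PiM PiE_iff split: nat.splits)
  have distr_S: "distr S D (\<lambda>x. x i) = D" for i
    by (rule PiM_component) simp
  have coord: "integrable S (\<lambda>x. x i)" for i
    using integrable_distr[of "\<lambda>x. x i" S D "\<lambda>s. s"] int by (simp add: distr_S)
  have mps_int: "integrable S (max_partial_sum n)" for n
  proof (rule Bochner_Integration.integrable_bound)
    show "integrable S (\<lambda>x. \<Sum>i<n. \<bar>x i\<bar>)"
      using coord by auto
    show "AE x in S. norm (max_partial_sum n x) \<le> norm (\<Sum>i<n. \<bar>x i\<bar>)"
      by (intro AE_I2) (use max_partial_sum_le_sum_abs max_partial_sum_nonneg in \<open>auto intro: order_trans[OF _ abs_ge_self]\<close>)
  qed (use D in measurable)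
  define f where "f n x = indicator A x * max_partial_sum n x" for n x
  have [measurable]: "f n \<in> borel_measurable S" for n
    unfolding f_def by measurable
  have f_int: "integrable S (f n)" for n
    unfolding f_def using mps_int[of n] integrable_mult_indicator[OF A mps_int[of n]] by simp
  define g where "g n = (\<lambda>(s, x). indicator A x * max (- max_partial_sum n x) s)" for n
  have Q_snd: "integrable ?Q (\<lambda>(s, x). f n x)" "(\<integral>p. (\<lambda>(s, x). f n x) p \<partial>?Q) = (\<integral>x. f n x \<partial>S)" for n
  proof -
    show "integrable ?Q (\<lambda>(s, x). f n x)" "(\<integral>p. (\<lambda>(s, x). f n x) p \<partial>?Q) = (\<integral>x. f n x \<partial>S)"
      using Q.integrable_integral_times[of "\<lambda>_. 1", OF _ f_int[of n]] by (simp_all add: D.prob_space)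
  qed
  \<comment> \<open>Prepending an independent step to the walk preserves its law.\<close>
  have Q_cons: "integrable ?Q (\<lambda>(s, x). f n (case_nat s x))"
    "(\<integral>p. (\<lambda>(s, x). f n (case_nat s x)) p \<partial>?Q) = (\<integral>x. f n x \<partial>S)" for n
  proof -
    have m: "(\<lambda>(s, x). case_nat s x) \<in> measurable ?Q S" by measurable
    have "integrable (distr ?Q S (\<lambda>(s, x). case_nat s x)) (f n)"
      unfolding PiM_iter by (rule f_int)
    from integrable_distr[OF m this] show "integrable ?Q (\<lambda>(s, x). f n (case_nat s x))"
      by (simp add: case_prod_unfold)
    have "(\<integral>x. f n x \<partial>S) = (\<integral>x. f n x \<partial>distr ?Q S (\<lambda>(s, x). case_nat s x))"
      unfolding PiM_iter ..
    also have "\<dots> = (\<integral>p. f n ((\<lambda>(s, x). case_nat s x) p) \<partial>?Q)"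
      by (rule integral_distr) (use m in auto)
    finally show "(\<integral>p. (\<lambda>(s, x). f n (case_nat s x)) p \<partial>?Q) = (\<integral>x. f n x \<partial>S)"
      by (simp add: case_prod_unfold)
  qed
  have g_eq: "g n (s, x) = f (Suc n) (case_nat s x) - f n x" if "s \<in> space D" "x \<in> space S" for n s x
    using case_nat_A[OF that] by (auto simp: g_def f_def indicator_def)
  have g_int: "(\<integral>p. g n p \<partial>?Q) \<ge> 0" for n
  proof -
    have "(\<integral>p. g n p \<partial>?Q) = (\<integral>p. (\<lambda>(s, x). f (Suc n) (case_nat s x)) p - (\<lambda>(s, x). f n x) p \<partial>?Q)"
      by (rule Bochner_Integration.integral_cong) (auto simp: g_eq space_pair_measure)
    also have "\<dots> = (\<integral>x. f (Suc n) x \<partial>S) - (\<integral>x. f n x \<partial>S)"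
      by (subst Bochner_Integration.integral_diff) (use Q_cons Q_snd in auto)
    also have "\<dots> = (\<integral>x. f (Suc n) x - f n x \<partial>S)"
      using f_int by simp
    also have "\<dots> \<ge> 0"
      by (rule Bochner_Integration.integral_nonneg)
        (use max_partial_sum_mono[of n] in \<open>auto simp: f_def indicator_def simp del: max_partial_sum.simps\<close>)
    finally show ?thesis .
  qed
  have lim: "(\<lambda>n. g n p) \<longlonglongrightarrow> (\<lambda>(s, x). s * indicator A x) p" if "p \<in> space ?Q" for p
  proof -
    obtain s x where p: "p = (s, x)" by (cases p)
    show ?thesis
    proof (cases "x \<in> A")
      case True
      then have "\<not> bounded_sums x" by (simp add: A_def)
      then obtain k where k: "(\<Sum>i<k. x i) > real (nat \<lceil>\<bar>s\<bar>\<rceil>)"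
        unfolding bounded_sums_def by (meson not_le)
      have "g n p = s" if "n \<ge> k" for n
        using k partial_sum_le_max_partial_sum[OF that, of x] True
        by (simp add: g_def p) linarith
      then show ?thesis
        by (intro tendsto_eventually) (auto simp: eventually_sequentially p True)
    qed (simp add: g_def p)
  qed
  have s_int: "integrable ?Q (\<lambda>(s, x). s * indicator A x)"
    "(\<integral>p. (\<lambda>(s, x). s * indicator A x) p \<partial>?Q) = (\<integral>s. s \<partial>D) * measure S A"
  proof -
    have "integrable S (indicator A :: _ \<Rightarrow> real)"
      using A by (intro integrable_real_indicator) (auto simp: P.emeasure_eq_measure)
    from Q.integrable_integral_times[OF int this]
    show "integrable ?Q (\<lambda>(s, x). s * indicator A x)"
      "(\<integral>p. (\<lambda>(s, x). s * indicator A x) p \<partial>?Q) = (\<integral>s. s \<partial>D) * measure S A"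
      using A by simp_all
  qed
  have "(\<lambda>n. \<integral>p. g n p \<partial>?Q) \<longlonglongrightarrow> (\<integral>p. (\<lambda>(s, x). s * indicator A x) p \<partial>?Q)"
  proof (rule integral_dominated_convergence[where w="\<lambda>(s, x). \<bar>s * indicator A x\<bar>"])
    show "integrable ?Q (\<lambda>(s, x). \<bar>s * indicator A x\<bar>)"
      using integrable_abs[OF s_int(1)] by (simp add: case_prod_unfold)
    show "AE p in ?Q. norm (g n p) \<le> (\<lambda>(s, x). \<bar>s * indicator A x\<bar>) p" for n
    proof (rule AE_I2)
      fix p
      show "norm (g n p) \<le> (\<lambda>(s, x). \<bar>s * indicator A x\<bar>) p"
        using max_partial_sum_nonneg[of n "snd p"] by (cases p) (auto simp: g_def indicator_def)
    qed
    show "g n \<in> borel_measurable ?Q" for n unfolding g_def by measurable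
  qed (use lim in auto)
  then have "0 \<le> (\<integral>s. s \<partial>D) * measure S A"
    unfolding s_int(2) using g_int by (intro LIMSEQ_le_const) auto
  with neg have "measure S A = 0"
    by (smt (verit) measure_nonneg mult_neg_pos)
  then have "A \<in> null_sets S"
    using A by (simp add: P.emeasure_eq_measure null_setsI)
  from AE_not_in[OF this] AE_space[of S] show ?thesis
    by eventually_elim (auto simp: A_def)
qed

lemma (in prob_space) AE_iid_bounded_sums:
  assumes indep: "indep_vars (\<lambda>_. borel) X UNIV"
    and ident: "\<And>i. distr M borel (X i) = distr M borel (X 0)"
    and int: "integrable M (X 0)" and neg: "expectation (X 0) < 0"
  shows "AE \<omega> in M. bounded_sums (\<lambda>i. X i \<omega>)"
proof -
  have rv [measurable]: "X i \<in> borel_measurable M" for i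
    using indep by (auto simp: indep_vars_def)
  let ?D = "distr M borel (X 0)" and ?B = "PiM UNIV (\<lambda>_::nat. borel :: real measure)"
  have "AE x in PiM UNIV (\<lambda>_. ?D). bounded_sums x"
    using int neg by (intro AE_product_bounded_sums prob_space_distr)
      (auto simp: integrable_distr_eq integral_distr)
  also have "PiM UNIV (\<lambda>_. ?D) = PiM UNIV (\<lambda>i. distr M borel (X i))"
    by (intro PiM_cong refl ident[symmetric])
  also have "\<dots> = distr M ?B (\<lambda>\<omega>. \<lambda>i\<in>UNIV. X i \<omega>)"
    using indep_vars_iff_distr_eq_PiM'[of UNIV X "\<lambda>_. borel"] indep by simp
  finally have "AE x in distr M ?B (\<lambda>\<omega> i. X i \<omega>). bounded_sums x"
    by (simp only: restrict_UNIV)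
  moreover have "(\<lambda>\<omega> i. X i \<omega>) \<in> measurable M ?B"
    by (rule measurable_PiM_single') (auto simp: space_PiM)
  moreover have "{x \<in> space ?B. bounded_sums x} \<in> sets ?B"
    unfolding bounded_sums_def by measurable
  ultimately show ?thesis
    by (simp add: AE_distr_iff)
qed

text \<open>
  The upper half of the strong law of large numbers: for \<open>d\<close> strictly between the mean and \<open>c\<close>, the
  variables \<open>h (Z i) - d\<close> have negative mean, so their sums stay below a constant, which the linear
  term \<open>n (c - d)\<close> eventually exceeds.
\<close>

lemma (in prob_space) AE_eventually_sum_less:
  fixes h :: "'b \<Rightarrow> real"
  assumes iid: "iid_sequence M N Z" and h [measurable]: "h \<in> borel_measurable N"
    and int: "integrable M (\<lambda>\<omega>. h (Z 0 \<omega>))" and less: "expectation (\<lambda>\<omega>. h (Z 0 \<omega>)) < c"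
  shows "AE \<omega> in M. \<forall>\<^sub>F n in sequentially. (\<Sum>i<n. h (Z i \<omega>)) < real n * c"
proof -
  obtain d where d: "expectation (\<lambda>\<omega>. h (Z 0 \<omega>)) < d" "d < c"
    using dense[OF less] by blast
  have indep: "indep_vars (\<lambda>_. N) Z UNIV" and ident: "distr M N (Z i) = distr M N (Z j)" for i j
    using iid by (auto simp: iid_sequence_def)
  have [measurable]: "Z i \<in> measurable M N" for i
    using indep by (auto simp: indep_vars_def)
  define X where "X i \<omega> = h (Z i \<omega>) - d" for i \<omega>
  have "AE \<omega> in M. bounded_sums (\<lambda>i. X i \<omega>)"
  proof (rule AE_iid_bounded_sums)
    show "indep_vars (\<lambda>_. borel) X UNIV"
      unfolding X_def by (rule indep_vars_compose2[OF indep, where Y="\<lambda>_ z. h z - d"]) measurable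
    have "distr M borel (X i) = distr (distr M N (Z i)) borel (\<lambda>z. h z - d)" for i
      by (subst distr_distr) (auto simp: X_def[abs_def] comp_def)
    then show "distr M borel (X i) = distr M borel (X 0)" for i
      by (metis ident)
    show "integrable M (X 0)" "expectation (X 0) < 0"
      using int d by (simp_all add: X_def[abs_def] prob_space)
  qed
  then show ?thesis
  proof eventually_elim
    case (elim \<omega>)
    then obtain C :: nat where "(\<Sum>i<n. X i \<omega>) \<le> real C" for n
      by (auto simp: bounded_sums_def)
    then have C: "(\<Sum>i<n. h (Z i \<omega>)) \<le> real C + real n * d" for n
      by (simp add: X_def sum_subtractf algebra_simps)
    have "\<forall>\<^sub>F n in sequentially. real n > real C / (c - d)"
      using filterlim_real_sequentially by (simp add: filterlim_at_top_dense)
    then show ?case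
    proof eventually_elim
      case (elim n)
      then have "real C < real n * (c - d)"
        using d by (simp add: field_simps)
      with C[of n] show ?case by (simp add: algebra_simps)
    qed
  qed
qed

section \<open>The Campbell formula\<close>

lemma space_configs: "space (configs S) = {c. set_mset c \<subseteq> S}"
  by (simp add: configs_def space_measure_of_conv)

lemma measurable_npoints:
  assumes "B \<in> sets borel" "B \<subseteq> S"
  shows "(\<lambda>c. npoints c B) \<in> measurable (configs S) (count_space UNIV)"
proof -
  have "(\<lambda>c. npoints c B) -` {k} \<inter> space (configs S) \<in> sets (configs S)" for k
  proof -
    have "(\<lambda>c. npoints c B) -` {k} \<inter> space (configs S) = {c. set_mset c \<subseteq> S \<and> npoints c B = k}"
      by (auto simp: space_configs)
    also have "\<dots> \<in> sets (configs S)"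
      unfolding configs_def using assms by (intro in_measure_of) auto
    finally show ?thesis .
  qed
  then show ?thesis
    by (auto simp: measurable_count_space_eq2_countable)
qed

lemma sum_mset_indicator: "(\<Sum>x\<in>#c. indicator B x :: ennreal) = of_nat (npoints c B)"
  by (induction c) (auto simp: npoints_def)

lemma npoints_Int: "set_mset c \<subseteq> S \<Longrightarrow> npoints c (B \<inter> S) = npoints c B"
  unfolding npoints_def by (rule arg_cong[of _ _ size], rule filter_mset_cong) auto

lemma incseq_sum_mset:
  fixes U :: "nat \<Rightarrow> 'a \<Rightarrow> ennreal"
  assumes "incseq U"
  shows "incseq (\<lambda>i. \<Sum>x\<in>#c. U i x)"
  using assms by (auto simp: incseq_def le_fun_def intro!: sum_mset_mono)

lemma sum_mset_SUP:
  fixes U :: "nat \<Rightarrow> 'a \<Rightarrow> ennreal"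
  assumes U: "incseq U"
  shows "(\<Sum>x\<in>#c. SUP i. U i x) = (SUP i. \<Sum>x\<in>#c. U i x)"
proof (induction c)
  case (add x c)
  have "incseq (\<lambda>i. U i x)"
    using U by (auto simp: incseq_def le_fun_def)
  then show ?case
    using add.IH ennreal_SUP_add[OF _ incseq_sum_mset[OF U], of "\<lambda>i. U i x" c] by simp
qed simp

lemma borel_measurable_sum_mset_ennreal:
  fixes g :: "'a::topological_space \<Rightarrow> ennreal"
  assumes S: "S \<in> sets borel" and "g \<in> borel_measurable borel"
  shows "(\<lambda>c. \<Sum>x\<in>#c. g x) \<in> borel_measurable (configs S)"
  using assms(2)
proof (induction rule: borel_measurable_induct)
  case (cong f g)
  then show ?case by simp
next
  case (set B)
  have "(\<lambda>c. of_nat (npoints c (B \<inter> S)) :: ennreal) \<in> borel_measurable (configs S)"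
    using S set by (intro measurable_compose[OF measurable_npoints, where g=of_nat]) auto
  then show ?case
    by (rule measurable_cong[THEN iffD1, rotated])
      (auto simp: space_configs npoints_Int sum_mset_indicator)
next
  case (mult g c)
  then show ?case by (simp add: sum_mset_distrib_left[symmetric])
next
  case (add f g)
  then show ?case by (simp add: sum_mset.distrib)
next
  case (seq U)
  then show ?case by (simp add: sum_mset_SUP image_comp)
qed

text \<open>
  The factor \<open>indicator S u\<close> stands inside because \<open>\<kappa>\<close> is arbitrary, and possibly not measurable,
  outside \<open>S\<close>.
\<close>

definition intensity_measure :: "'a::euclidean_space set \<Rightarrow> ('a \<Rightarrow> real) \<Rightarrow> 'a measure" where
  "intensity_measure S \<kappa> = density lborel (\<lambda>u. ennreal (indicator S u * \<kappa> u))"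

lemma sets_intensity_measure [measurable_cong, simp]: "sets (intensity_measure S \<kappa>) = sets borel"
  by (simp add: intensity_measure_def)

lemma emeasure_intensity_measure:
  assumes "(\<lambda>u. indicator S u * \<kappa> u) \<in> borel_measurable borel" "B \<in> sets borel"
  shows "emeasure (intensity_measure S \<kappa>) B = (\<integral>\<^sup>+u\<in>B \<inter> S. ennreal (\<kappa> u) \<partial>lborel)"
  unfolding intensity_measure_def using assms
  by (subst emeasure_density) (auto intro!: nn_integral_cong simp: indicator_def)

lemma has_intensity_measurable:
  assumes "has_intensity P S Z \<kappa>" "S \<in> sets borel"
  shows "(\<lambda>u. indicator S u * \<kappa> u) \<in> borel_measurable borel"
  using assms borel_measurable_restrict_space_iff[of S borel \<kappa>] by (simp add: has_intensity_def)

text \<open>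
  For indicators this is the definition of an intensity function; both sides are additive,
  homogeneous and continuous along increasing sequences in \<open>g\<close>.
\<close>

theorem campbell_nn:
  fixes g :: "'a::euclidean_space \<Rightarrow> ennreal"
  assumes S: "S \<in> sets borel" and Z: "has_intensity P S Z \<kappa>" and g: "g \<in> borel_measurable borel"
  shows "(\<integral>\<^sup>+\<omega>. (\<Sum>x\<in>#Z \<omega>. g x) \<partial>P) = (\<integral>\<^sup>+u. g u \<partial>intensity_measure S \<kappa>)"
proof -
  note meas = has_intensity_measurable[OF Z S]
  have Zm: "Z \<in> measurable P (configs S)"
    using Z by (simp add: has_intensity_def point_process_def)
  have sum_meas: "(\<lambda>\<omega>. \<Sum>x\<in>#Z \<omega>. g x) \<in> borel_measurable P"
    if "g \<in> borel_measurable borel" for g :: "'a \<Rightarrow> ennreal"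
    using measurable_compose[OF Zm borel_measurable_sum_mset_ennreal[OF S that]] .
  have subset: "set_mset (Z \<omega>) \<subseteq> S" if "\<omega> \<in> space P" for \<omega>
    using measurable_space[OF Zm that] by (simp add: space_configs)
  from g show ?thesis
  proof (induction rule: borel_measurable_induct)
    case (cong f g)
    then show ?case by simp
  next
    case (set B)
    have "(\<integral>\<^sup>+\<omega>. (\<Sum>x\<in>#Z \<omega>. indicator B x) \<partial>P) = (\<integral>\<^sup>+\<omega>. of_nat (npoints (Z \<omega>) (B \<inter> S)) \<partial>P)"
      by (intro nn_integral_cong) (simp add: sum_mset_indicator npoints_Int subset)
    also have "\<dots> = emeasure (intensity_measure S \<kappa>) B"
      using Z S set by (simp add: has_intensity_def emeasure_intensity_measure meas)
    finally show ?case using set by simp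
  next
    case (mult g c)
    then show ?case
      by (simp add: sum_mset_distrib_left[symmetric] nn_integral_cmult sum_meas)
  next
    case (add f g)
    then show ?case by (simp add: sum_mset.distrib nn_integral_add sum_meas)
  next
    case (seq U)
    have "(\<integral>\<^sup>+\<omega>. (\<Sum>x\<in>#Z \<omega>. (SUP i. U i) x) \<partial>P) = (\<integral>\<^sup>+\<omega>. (SUP i. \<Sum>x\<in>#Z \<omega>. U i x) \<partial>P)"
      using seq by (simp add: sum_mset_SUP image_comp)
    also have "\<dots> = (SUP i. \<integral>\<^sup>+\<omega>. (\<Sum>x\<in>#Z \<omega>. U i x) \<partial>P)"
    proof (rule nn_integral_monotone_convergence_SUP)
      show "incseq (\<lambda>i \<omega>. \<Sum>x\<in>#Z \<omega>. U i x)"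
        using incseq_sum_mset[OF seq(3)] by (simp add: incseq_def le_fun_def)
    qed (use seq in \<open>simp add: sum_meas\<close>)
    also have "\<dots> = (\<integral>\<^sup>+u. (SUP i. U i u) \<partial>intensity_measure S \<kappa>)"
      using seq by (subst nn_integral_monotone_convergence_SUP) auto
    finally show ?case by (simp add: image_comp)
  qed
qed

lemma sum_mset_nonneg_real: "(\<And>x. 0 \<le> h x) \<Longrightarrow> 0 \<le> (\<Sum>x\<in>#c. h x :: real)"
  by (induction c) auto

lemma sum_mset_ennreal:
  assumes "\<And>x. 0 \<le> h x"
  shows "(\<Sum>x\<in>#c. ennreal (h x)) = ennreal (\<Sum>x\<in>#c. h x)"
  by (induction c) (simp_all add: assms sum_mset_nonneg_real)

lemma sum_mset_diff: "(\<Sum>x\<in>#c. f x - g x :: real) = (\<Sum>x\<in>#c. f x) - (\<Sum>x\<in>#c. g x)"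
  by (induction c) auto

lemma borel_measurable_sum_mset:
  fixes h :: "'a::topological_space \<Rightarrow> real"
  assumes S: "S \<in> sets borel" and h [measurable]: "h \<in> borel_measurable borel"
  shows "(\<lambda>c. \<Sum>x\<in>#c. h x) \<in> borel_measurable (configs S)"
proof -
  have nonneg: "(\<lambda>c. \<Sum>x\<in>#c. f x) \<in> borel_measurable (configs S)"
    if [measurable]: "f \<in> borel_measurable borel" and "\<And>x. 0 \<le> f x" for f :: "'a \<Rightarrow> real"
  proof -
    have "(\<lambda>c. enn2real (\<Sum>x\<in>#c. ennreal (f x))) \<in> borel_measurable (configs S)"
      by (intro borel_measurable_enn2real borel_measurable_sum_mset_ennreal S) measurable
    then show ?thesis using that by (simp add: sum_mset_ennreal sum_mset_nonneg_real)
  qed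
  have "(\<Sum>x\<in>#c. h x) = (\<Sum>x\<in>#c. max 0 (h x)) - (\<Sum>x\<in>#c. max 0 (- h x))" for c
    unfolding sum_mset_diff[symmetric] by (rule arg_cong[of _ _ sum_mset], rule image_mset_cong) auto
  then have "(\<lambda>c. \<Sum>x\<in>#c. h x) = (\<lambda>c. (\<Sum>x\<in>#c. max 0 (h x)) - (\<Sum>x\<in>#c. max 0 (- h x)))"
    by (rule ext)
  also have "\<dots> \<in> borel_measurable (configs S)"
    by (intro borel_measurable_diff nonneg) auto
  finally show ?thesis .
qed

theorem campbell:
  fixes h :: "'a::euclidean_space \<Rightarrow> real"
  assumes S: "S \<in> sets borel" and Z: "has_intensity P S Z \<kappa>"
    and h: "integrable (intensity_measure S \<kappa>) h"
  shows "has_bochner_integral P (\<lambda>\<omega>. \<Sum>x\<in>#Z \<omega>. h x) (\<integral>u. h u \<partial>intensity_measure S \<kappa>)"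
proof -
  have Zm: "Z \<in> measurable P (configs S)"
    using Z by (simp add: has_intensity_def point_process_def)
  have nonneg: "has_bochner_integral P (\<lambda>\<omega>. \<Sum>x\<in>#Z \<omega>. f x) (\<integral>u. f u \<partial>intensity_measure S \<kappa>)"
    if f: "integrable (intensity_measure S \<kappa>) f" "\<And>x. 0 \<le> f x" for f :: "'a \<Rightarrow> real"
  proof (rule has_bochner_integral_nn_integral)
    have [measurable]: "f \<in> borel_measurable borel"
      using borel_measurable_integrable[OF f(1)] by simp
    show "(\<lambda>\<omega>. \<Sum>x\<in>#Z \<omega>. f x) \<in> borel_measurable P"
      by (rule measurable_compose[OF Zm borel_measurable_sum_mset[OF S]]) measurable
    have "(\<integral>\<^sup>+\<omega>. ennreal (\<Sum>x\<in>#Z \<omega>. f x) \<partial>P) = (\<integral>\<^sup>+u. ennreal (f u) \<partial>intensity_measure S \<kappa>)"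
      using campbell_nn[OF S Z, of "\<lambda>x. ennreal (f x)"] f by (simp add: sum_mset_ennreal)
    then show "(\<integral>\<^sup>+\<omega>. ennreal (\<Sum>x\<in>#Z \<omega>. f x) \<partial>P) = ennreal (\<integral>u. f u \<partial>intensity_measure S \<kappa>)"
      using f by (simp add: nn_integral_eq_integral)
  qed (use f in \<open>auto simp: sum_mset_nonneg_real\<close>)
  let ?pos = "\<lambda>u. max 0 (h u)" and ?neg = "\<lambda>u. max 0 (- h u)"
  have "has_bochner_integral P (\<lambda>\<omega>. (\<Sum>x\<in>#Z \<omega>. ?pos x) - (\<Sum>x\<in>#Z \<omega>. ?neg x))
      ((\<integral>u. ?pos u \<partial>intensity_measure S \<kappa>) - (\<integral>u. ?neg u \<partial>intensity_measure S \<kappa>))"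
    using h by (intro has_bochner_integral_diff nonneg) auto
  also have "(\<integral>u. ?pos u \<partial>intensity_measure S \<kappa>) - (\<integral>u. ?neg u \<partial>intensity_measure S \<kappa>)
      = (\<integral>u. ?pos u - ?neg u \<partial>intensity_measure S \<kappa>)"
    using h by (intro Bochner_Integration.integral_diff[symmetric]) auto
  also have "(\<lambda>u. ?pos u - ?neg u) = h" by auto
  also have "(\<lambda>\<omega>. (\<Sum>x\<in>#Z \<omega>. ?pos x) - (\<Sum>x\<in>#Z \<omega>. ?neg x)) = (\<lambda>\<omega>. \<Sum>x\<in>#Z \<omega>. h x)"
    unfolding sum_mset_diff[symmetric] by (intro ext arg_cong[of _ _ sum_mset] image_mset_cong) auto
  finally show ?thesis .
qed

text \<open>
  The parameter may be 0, hence the Poisson weights appear explicitly.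
\<close>

lemma (in prob_space) nn_integral_poisson:
  fixes N :: "'a \<Rightarrow> nat"
  assumes N [measurable]: "N \<in> measurable M (count_space UNIV)" and \<mu>: "0 \<le> \<mu>"
    and pois: "\<And>k. prob {\<omega> \<in> space M. N \<omega> = k} = \<mu> ^ k / fact k * exp (- \<mu>)"
  shows "(\<integral>\<^sup>+\<omega>. of_nat (N \<omega>) \<partial>M) = ennreal \<mu>"
proof -
  let ?p = "\<lambda>k. \<mu> ^ k / fact k * exp (- \<mu>)"
  have "distr M (count_space UNIV) N = density (count_space UNIV) (\<lambda>k. ennreal (?p k))"
  proof (rule measure_eqI_countable[of _ UNIV])
    fix k
    have "N -` {k} \<inter> space M = {\<omega> \<in> space M. N \<omega> = k}" by auto
    then show "emeasure (distr M (count_space UNIV) N) {k} =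
        emeasure (density (count_space UNIV) (\<lambda>k. ennreal (?p k))) {k}"
      by (simp add: emeasure_distr emeasure_eq_measure pois emeasure_density nn_integral_count_space_indicator[symmetric])
  qed auto
  then have "(\<integral>\<^sup>+\<omega>. of_nat (N \<omega>) \<partial>M) = (\<integral>\<^sup>+k. of_nat k \<partial>density (count_space UNIV) (\<lambda>k. ennreal (?p k)))"
    using nn_integral_distr[OF N, of of_nat] by simp
  also have "\<dots> = (\<Sum>k. ennreal (?p k * real k))"
    using \<mu> by (simp add: nn_integral_density nn_integral_count_space_nat ennreal_mult[symmetric] ennreal_of_nat_eq_real_of_nat)
  also have "\<dots> = ennreal \<mu>"
  proof (rule suminf_ennreal_eq)
    \<comment> \<open>The term with index \<open>k + 1\<close> is \<open>\<mu>\<close> times the Poisson weight of \<open>k\<close>, and the term with index 0 vanishes.\<close>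
    have "(\<lambda>k. \<mu> * exp (- \<mu>) * (\<mu> ^ k /\<^sub>R fact k)) sums (\<mu> * exp (- \<mu>) * exp \<mu>)"
      by (intro sums_mult exp_converges)
    also have "\<mu> * exp (- \<mu>) * exp \<mu> = \<mu>" by (simp add: exp_minus)
    also have "(\<lambda>k. \<mu> * exp (- \<mu>) * (\<mu> ^ k /\<^sub>R fact k)) = (\<lambda>k. ?p (Suc k) * real (Suc k))"
      by (rule ext) (simp add: field_simps del: of_nat_Suc)
    finally show "(\<lambda>k. ?p k * real k) sums \<mu>"
      by (subst (asm) sums_Suc_iff) simp
  qed (use \<mu> in auto)
  finally show ?thesis .
qed

lemma poisson_process_has_intensity:
  assumes "prob_space P" and S: "S \<in> sets borel" and Z: "poisson_process P S Z \<kappa>"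
  shows "has_intensity P S Z \<kappa>"
  unfolding has_intensity_def
proof (intro conjI ballI allI impI)
  interpret prob_space P by fact
  have Zm: "Z \<in> measurable P (configs S)" and int: "set_integrable lborel S \<kappa>"
    and nonneg: "\<And>u. u \<in> S \<Longrightarrow> 0 \<le> \<kappa> u"
    using Z by (auto simp: poisson_process_def point_process_def)
  show "point_process P S Z" by (simp add: point_process_def Zm)
  show "\<kappa> \<in> borel_measurable (restrict_space borel S)"
    using S int borel_measurable_restrict_space_iff[of S borel \<kappa>]
    by (auto simp: set_integrable_def dest: borel_measurable_integrable)
  show "0 \<le> \<kappa> u" if "u \<in> S" for u using nonneg that .
  fix B assume B: "B \<in> sets borel" "B \<subseteq> S"
  have intB: "set_integrable lborel B \<kappa>"
    using int B by (auto intro: set_integrable_subset)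
  have "(\<integral>\<^sup>+\<omega>. of_nat (npoints (Z \<omega>) B) \<partial>P) = ennreal (LINT u:B|lborel. \<kappa> u)"
  proof (rule nn_integral_poisson)
    show "(\<lambda>\<omega>. npoints (Z \<omega>) B) \<in> measurable P (count_space UNIV)"
      by (rule measurable_compose[OF Zm measurable_npoints[OF B]])
    show "0 \<le> (LINT u:B|lborel. \<kappa> u)"
      unfolding set_lebesgue_integral_def using B nonneg
      by (intro Bochner_Integration.integral_nonneg) (auto simp: indicator_def)
  qed (use Z B in \<open>auto simp: poisson_process_def\<close>)
  also have "\<dots> = (\<integral>\<^sup>+u. ennreal (indicator B u *\<^sub>R \<kappa> u) \<partial>lborel)"
    using intB B nonneg unfolding set_integrable_def set_lebesgue_integral_def
    by (intro nn_integral_eq_integral[symmetric]) (auto simp: indicator_def)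
  also have "\<dots> = (\<integral>\<^sup>+u\<in>B. ennreal (\<kappa> u) \<partial>lborel)"
    by (intro nn_integral_cong) (auto simp: indicator_def)
  finally show "(\<integral>\<^sup>+\<omega>. of_nat (npoints (Z \<omega>) B) \<partial>P) = (\<integral>\<^sup>+u\<in>B. ennreal (\<kappa> u) \<partial>lborel)" .
qed

lemma sum_mset_superposition:
  "(\<Sum>x\<in>#superposition Z n \<omega>. h x) = (\<Sum>i<n. \<Sum>x\<in>#Z i \<omega>. h x)"
  unfolding superposition_def by (induction n) auto

lemma set_mset_superposition_subset:
  "(\<And>i. set_mset (Z i \<omega>) \<subseteq> S) \<Longrightarrow> set_mset (superposition Z n \<omega>) \<subseteq> S"
  unfolding superposition_def by (induction n) auto

lemma (in prob_space) AE_eventually_superposition_less: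
  fixes h :: "'b::euclidean_space \<Rightarrow> real"
  assumes S: "S \<in> sets borel" and iid: "iid_sequence M (configs S) Z"
    and Z: "has_intensity M S (Z 0) \<kappa>"
    and h: "integrable (intensity_measure S \<kappa>) h"
    and less: "(\<integral>u. h u \<partial>intensity_measure S \<kappa>) < c"
  shows "AE \<omega> in M. \<forall>\<^sub>F n in sequentially. (\<Sum>x\<in>#superposition Z n \<omega>. h x) < real n * c"
  unfolding sum_mset_superposition
proof (rule AE_eventually_sum_less[OF iid])
  show "(\<lambda>c. \<Sum>x\<in>#c. h x) \<in> borel_measurable (configs S)"
    using borel_measurable_integrable[OF h] by (intro borel_measurable_sum_mset[OF S]) simp
  show "integrable M (\<lambda>\<omega>. \<Sum>x\<in>#Z 0 \<omega>. h x)" "expectation (\<lambda>\<omega>. \<Sum>x\<in>#Z 0 \<omega>. h x) < c"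
    using campbell[OF S Z h] less by (auto simp: has_bochner_integral_iff)
qed

lemma integrable_intensity_measure_bounded:
  fixes h :: "'a::euclidean_space \<Rightarrow> real"
  assumes \<kappa>: "set_integrable lborel S \<kappa>" "\<And>u. u \<in> S \<Longrightarrow> 0 \<le> \<kappa> u"
    and h [measurable]: "h \<in> borel_measurable borel" and bound: "\<And>u. \<bar>h u\<bar> \<le> C"
  shows "integrable (intensity_measure S \<kappa>) h"
proof -
  have int: "integrable lborel (\<lambda>u. indicator S u * \<kappa> u)"
    using \<kappa>(1) by (simp add: set_integrable_def)
  note [measurable] = borel_measurable_integrable[OF int]
  have nonneg: "0 \<le> indicator S u * \<kappa> u" for u
    using \<kappa>(2) by (auto simp: indicator_def)
  have "integrable lborel (\<lambda>u. (indicator S u * \<kappa> u) *\<^sub>R h u)"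
  proof (rule Bochner_Integration.integrable_bound)
    show "integrable lborel (\<lambda>u. C * (indicator S u * \<kappa> u))"
      using int by simp
    have "\<bar>h u\<bar> \<le> \<bar>C\<bar>" for u using bound[of u] by linarith
    then show "AE u in lborel. norm ((indicator S u * \<kappa> u) *\<^sub>R h u) \<le> norm (C * (indicator S u * \<kappa> u))"
      by (intro AE_I2) (auto simp: abs_mult mult.commute intro!: mult_right_mono)
  qed measurable
  then show ?thesis
    unfolding intensity_measure_def using nonneg by (subst integrable_density) auto
qed

section \<open>The logistic log-likelihood\<close>

definition softplus :: "real \<Rightarrow> real" where
  "softplus t = ln (1 + exp t)"

lemma softplus_lipschitz: "\<bar>softplus s - softplus t\<bar> \<le> \<bar>s - t\<bar>"
proof -
  have *: "softplus y - softplus x \<le> y - x" if "x \<le> y" for x y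
  proof -
    have "1 + exp y \<le> exp (y - x) * (1 + exp x)"
      using that by (simp add: algebra_simps flip: exp_add)
    then have "ln (1 + exp y) \<le> ln (exp (y - x) * (1 + exp x))"
      by (subst ln_le_cancel_iff) (auto intro!: mult_pos_pos add_pos_pos)
    also have "\<dots> = (y - x) + ln (1 + exp x)"
      using add_pos_pos[OF zero_less_one exp_gt_zero[of x]] by (subst ln_mult) auto
    finally show ?thesis by (simp add: softplus_def)
  qed
  have mono: "softplus x \<le> softplus y" if "x \<le> y" for x y
    using that by (simp add: softplus_def add_pos_pos)
  show ?thesis
    using *[of s t] *[of t s] mono[of s t] mono[of t s] by (cases "s \<le> t") auto
qed

lemma convex_softplus: "convex_on UNIV softplus"
proof (rule convex_on_realI[where f'="\<lambda>t. 1 - 1 / (1 + exp t)"])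
  fix x :: real
  have "1 + exp x > 0" by (simp add: add_pos_pos)
  then show "(softplus has_real_derivative 1 - 1 / (1 + exp x)) (at x)"
    unfolding softplus_def[abs_def] by (auto intro!: derivative_eq_intros simp: field_simps)
next
  fix x y :: real assume "x \<le> y"
  then show "1 - 1 / (1 + exp x) \<le> 1 - 1 / (1 + exp y)"
    by (auto intro!: divide_left_mono simp: add_pos_pos)
qed auto

lemma ln_odds_ratio:
  fixes a r :: real
  assumes "0 < a" "0 < r"
  shows "ln (a / (a + r)) = - softplus (- ln (a / r))"
proof -
  have "1 + exp (- ln (a / r)) = inverse (a / (a + r))"
    using assms by (simp add: exp_minus field_simps)
  then show ?thesis
    using assms by (simp add: softplus_def ln_div)
qed

lemma ln_loglinear_odds:
  assumes "0 < b u" "0 < r"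
  shows "ln (loglinear_intensity b z \<theta> u / r) = \<theta> \<bullet> z u + ln (b u / r)"
  using assms by (simp add: loglinear_intensity_def ln_mult ln_div)

lemma loglinear_intensity_pos: "0 < b u \<Longrightarrow> 0 < loglinear_intensity b z \<theta> u"
  by (simp add: loglinear_intensity_def)

text \<open>
  The log-likelihood contributions of a data point and of a dummy point as functions of the linear
  predictor \<open>\<theta> \<bullet> z u + ln (b u / \<rho> u)\<close>; concavity and the Lipschitz bound are read off from here.
\<close>

lemma ln_type_prob_eq:
  fixes b \<rho> :: "'a \<Rightarrow> real"
  assumes "0 < b u" "0 < \<rho> u"
  shows "ln (loglinear_intensity b z \<theta> u / (loglinear_intensity b z \<theta> u + \<rho> u))
           = - softplus (- (\<theta> \<bullet> z u + ln (b u / \<rho> u)))"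
    and "ln (\<rho> u / (loglinear_intensity b z \<theta> u + \<rho> u))
           = - softplus (\<theta> \<bullet> z u + ln (b u / \<rho> u))"
proof -
  note pos = loglinear_intensity_pos[of b u z \<theta>, OF assms(1)]
  show "ln (loglinear_intensity b z \<theta> u / (loglinear_intensity b z \<theta> u + \<rho> u))
           = - softplus (- (\<theta> \<bullet> z u + ln (b u / \<rho> u)))"
    using ln_odds_ratio[OF pos assms(2)] by (simp only: ln_loglinear_odds[of b u "\<rho> u", OF assms])
  have "ln (\<rho> u / loglinear_intensity b z \<theta> u) = - ln (loglinear_intensity b z \<theta> u / \<rho> u)"
    using pos assms by (simp add: ln_div)
  then show "ln (\<rho> u / (loglinear_intensity b z \<theta> u + \<rho> u))
           = - softplus (\<theta> \<bullet> z u + ln (b u / \<rho> u))"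
    using ln_odds_ratio[OF assms(2) pos] ln_loglinear_odds[of b u "\<rho> u" z \<theta>, OF assms]
    by (simp add: add.commute)
qed

lemma ln_type_prob_lipschitz:
  fixes b \<rho> :: "'a \<Rightarrow> real"
  assumes "0 < b u" "0 < \<rho> u" "norm (z u) \<le> K"
  defines "lam \<equiv> loglinear_intensity b z"
  shows "\<bar>ln (lam \<theta> u / (lam \<theta> u + \<rho> u)) - ln (lam \<theta>' u / (lam \<theta>' u + \<rho> u))\<bar> \<le> K * dist \<theta> \<theta>'"
    and "\<bar>ln (\<rho> u / (lam \<theta> u + \<rho> u)) - ln (\<rho> u / (lam \<theta>' u + \<rho> u))\<bar> \<le> K * dist \<theta> \<theta>'"
proof -
  have "\<bar>\<theta> \<bullet> z u - \<theta>' \<bullet> z u\<bar> \<le> norm (\<theta> - \<theta>') * norm (z u)"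
    using Cauchy_Schwarz_ineq2[of "\<theta> - \<theta>'" "z u"] by (simp add: inner_diff_left)
  also have "\<dots> \<le> K * dist \<theta> \<theta>'"
    using assms(3) by (simp add: dist_norm mult.commute mult_right_mono)
  finally have *: "\<bar>\<theta> \<bullet> z u - \<theta>' \<bullet> z u\<bar> \<le> K * dist \<theta> \<theta>'" .
  let ?c = "ln (b u / \<rho> u)"
  show "\<bar>ln (lam \<theta> u / (lam \<theta> u + \<rho> u)) - ln (lam \<theta>' u / (lam \<theta>' u + \<rho> u))\<bar> \<le> K * dist \<theta> \<theta>'"
    unfolding lam_def ln_type_prob_eq(1)[of b u \<rho>, OF assms(1,2)]
    using softplus_lipschitz[of "- (\<theta> \<bullet> z u + ?c)" "- (\<theta>' \<bullet> z u + ?c)"] * by linarith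
  show "\<bar>ln (\<rho> u / (lam \<theta> u + \<rho> u)) - ln (\<rho> u / (lam \<theta>' u + \<rho> u))\<bar> \<le> K * dist \<theta> \<theta>'"
    unfolding lam_def ln_type_prob_eq(2)[of b u \<rho>, OF assms(1,2)]
    using softplus_lipschitz[of "\<theta> \<bullet> z u + ?c" "\<theta>' \<bullet> z u + ?c"] * by linarith
qed

lemma concave_neg_softplus_affine:
  fixes v :: "'v::real_inner"
  shows "concave_on UNIV (\<lambda>\<theta>. - softplus (\<theta> \<bullet> v + c))"
  unfolding concave_on_def convex_on_def
proof (intro conjI ballI allI impI)
  fix x y :: 'v and s t :: real
  assume st: "0 \<le> s" "0 \<le> t" "s + t = 1"
  have "(s *\<^sub>R x + t *\<^sub>R y) \<bullet> v + c = s *\<^sub>R (x \<bullet> v + c) + t *\<^sub>R (y \<bullet> v + c)"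
    using st by (simp add: inner_add_left algebra_simps flip: distrib_left)
  then show "- (- softplus ((s *\<^sub>R x + t *\<^sub>R y) \<bullet> v + c))
      \<le> s * - (- softplus (x \<bullet> v + c)) + t * - (- softplus (y \<bullet> v + c))"
    using convex_softplus st unfolding convex_on_def by (metis UNIV_I minus_minus)
qed simp

lemma concave_on_sum_mset:
  fixes f :: "'a \<Rightarrow> 'v::real_vector \<Rightarrow> real"
  assumes "\<And>x. x \<in># c \<Longrightarrow> concave_on UNIV (f x)"
  shows "concave_on UNIV (\<lambda>\<theta>. \<Sum>x\<in>#c. f x \<theta>)"
  using assms
proof (induction c)
  case empty
  show ?case by (simp add: concave_on_def convex_on_const)
next
  case (add x c)
  then show ?case by (simp add: concave_on_add)
qed

lemma concave_logistic_loglik: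
  assumes "\<And>u. u \<in># X + D \<Longrightarrow> 0 < b u" "\<And>u. u \<in># X + D \<Longrightarrow> 0 < \<rho> u"
  shows "concave_on UNIV (logistic_loglik (loglinear_intensity b z) \<rho> X D)"
  unfolding logistic_loglik_def[abs_def]
proof (intro concave_on_add concave_on_sum_mset)
  fix u assume "u \<in># X"
  then show "concave_on UNIV
      (\<lambda>\<theta>. ln (loglinear_intensity b z \<theta> u / (loglinear_intensity b z \<theta> u + \<rho> u)))"
    using assms concave_neg_softplus_affine[of "- z u" "- ln (b u / \<rho> u)"]
    by (simp add: ln_type_prob_eq)
next
  fix u assume "u \<in># D"
  then show "concave_on UNIV (\<lambda>\<theta>. ln (\<rho> u / (loglinear_intensity b z \<theta> u + \<rho> u)))"
    using assms concave_neg_softplus_affine[of "z u" "ln (b u / \<rho> u)"]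
    by (simp add: ln_type_prob_eq)
qed

text \<open>
  If \<open>x\<close> lay on or outside the sphere, the segment from \<open>a\<close> to \<open>x\<close> would meet the sphere, and there
  concavity gives a value of at least \<open>min (f a) (f x) = f a\<close>.
\<close>

lemma concave_superlevel_in_ball:
  fixes f :: "'v::real_normed_vector \<Rightarrow> real"
  assumes f: "concave_on UNIV f" and "0 < e" and sphere: "\<And>x. dist x a = e \<Longrightarrow> f x < f a"
    and x: "f a \<le> f x"
  shows "dist x a < e"
proof (rule ccontr)
  assume "\<not> dist x a < e"
  then have e: "e \<le> norm (x - a)" by (simp add: dist_norm)
  define t where "t = e / norm (x - a)"
  have t: "0 \<le> t" "t \<le> 1" "t * norm (x - a) = e"
    using e \<open>0 < e\<close> by (auto simp: t_def divide_le_eq)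
  let ?y = "(1 - t) *\<^sub>R a + t *\<^sub>R x"
  have "?y - a = t *\<^sub>R (x - a)" by (simp add: algebra_simps)
  then have "dist ?y a = e" using t by (simp add: dist_norm)
  then have "f ?y < f a" by (rule sphere)
  moreover have "(1 - t) * f a + t * f x \<le> f ?y"
    using concave_onD[OF f, of t a x] t by simp
  moreover have "t * f a \<le> t * f x" using t x by (intro mult_left_mono)
  ultimately show False by (simp add: algebra_simps)
qed

section \<open>The mean gain of the log-likelihood\<close>

text \<open>
  With \<open>a = \<lambda>(u;\<theta>\<^sub>0)\<close>, \<open>a' = \<lambda>(u;\<theta>)\<close> and \<open>r = \<rho>(u)\<close>, the left-hand side is the density at \<open>u\<close> of the
  mean gain; divided by \<open>- (a + r)\<close> it is the Kullback-Leibler divergence between the Bernoulli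
  laws with parameters \<open>a / (a + r)\<close> and \<open>a' / (a' + r)\<close>.  The linear terms that the right-hand
  side adds cancel, since both pairs of probabilities sum to 1.  They make each summand nonpositive
  by \<open>ln p \<le> p - 1\<close>.
\<close>

lemma logistic_gain_eq:
  fixes a r a' :: real
  assumes "0 < a" "0 < r" "0 < a'"
  defines "p \<equiv> (a' / (a' + r)) / (a / (a + r))" and "q \<equiv> (r / (a' + r)) / (r / (a + r))"
  shows "a * (ln (a' / (a' + r)) - ln (a / (a + r))) + r * (ln (r / (a' + r)) - ln (r / (a + r)))
           = a * (ln p - (p - 1)) + r * (ln q - (q - 1))"
proof -
  have "a * (p - 1) + r * (q - 1) = 0"
    using assms(1-3) by (simp add: p_def q_def divide_simps) (simp add: algebra_simps)
  moreover have "ln p = ln (a' / (a' + r)) - ln (a / (a + r))"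
    "ln q = ln (r / (a' + r)) - ln (r / (a + r))"
    unfolding p_def q_def using assms(1-3) by (subst ln_div; simp)+
  moreover have "a * (ln p - (p - 1)) + r * (ln q - (q - 1)) = a * ln p + r * ln q - (a * (p - 1) + r * (q - 1))"
    by (simp add: algebra_simps)
  ultimately show ?thesis by simp
qed

lemma logistic_gain_nonpos:
  fixes a r a' :: real
  assumes "0 < a" "0 < r" "0 < a'"
  shows "a * (ln (a' / (a' + r)) - ln (a / (a + r))) + r * (ln (r / (a' + r)) - ln (r / (a + r))) \<le> 0"
proof -
  have "a * (ln p - (p - 1)) \<le> 0" "r * (ln p - (p - 1)) \<le> 0" if "0 < p" for p
    using ln_le_minus_one[OF that] assms by (auto simp: mult_le_0_iff)
  then show ?thesis
    unfolding logistic_gain_eq[OF assms] by (intro add_nonpos_nonpos) (use assms in simp_all)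
qed

lemma logistic_gain_eq_0D:
  fixes a r a' :: real
  assumes "0 < a" "0 < r" "0 < a'"
    and gain: "a * (ln (a' / (a' + r)) - ln (a / (a + r))) + r * (ln (r / (a' + r)) - ln (r / (a + r))) = 0"
  shows "a' = a"
proof -
  define p q where "p = (a' / (a' + r)) / (a / (a + r))" and "q = (r / (a' + r)) / (r / (a + r))"
  have pos: "0 < p" "0 < q" using assms by (simp_all add: p_def q_def)
  have "a * (ln p - (p - 1)) \<le> 0" "r * (ln q - (q - 1)) \<le> 0"
    using ln_le_minus_one pos assms by (auto simp: mult_le_0_iff)
  moreover have "a * (ln p - (p - 1)) + r * (ln q - (q - 1)) = 0"
    using logistic_gain_eq[OF assms(1-3)] gain by (simp add: p_def q_def)
  ultimately have "r * (ln q - (q - 1)) = 0" by linarith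
  then have "q = 1" using assms pos ln_eq_minus_one by auto
  then show ?thesis using assms by (simp add: q_def divide_simps)
qed

text \<open>
  The changes in the contribution of a data point and of a dummy point at \<open>u\<close> when the intensity \<open>a\<close>
  is replaced by \<open>a'\<close>, extended by 0 outside \<open>S\<close> so that they can be measurable on the whole space.
\<close>

definition data_gain where
  "data_gain S a r a' u = indicator S u * (ln (a' u / (a' u + r u)) - ln (a u / (a u + r u)) :: real)"

definition dummy_gain where
  "dummy_gain S a r a' u = indicator S u * (ln (r u / (a' u + r u)) - ln (r u / (a u + r u)) :: real)"

text \<open>
  Integrated over \<open>S\<close>, the nonpositive density of the mean gain can only vanish if it vanishes almost
  everywhere, and this means that \<open>a'\<close> and \<open>a\<close> agree almost everywhere.
\<close>

lemma expected_gain_neg: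
  fixes a a' r :: "'a::euclidean_space \<Rightarrow> real"
  assumes pos: "\<And>u. u \<in> S \<Longrightarrow> 0 < a u" "\<And>u. u \<in> S \<Longrightarrow> 0 < a' u" "\<And>u. u \<in> S \<Longrightarrow> 0 < r u"
    and a [measurable]: "(\<lambda>u. indicator S u * a u) \<in> borel_measurable borel"
    and r [measurable]: "(\<lambda>u. indicator S u * r u) \<in> borel_measurable borel"
    and data: "integrable (intensity_measure S a) (data_gain S a r a')"
    and dummy: "integrable (intensity_measure S r) (dummy_gain S a r a')"
    and neq: "\<not> (AE u in lborel. u \<in> S \<longrightarrow> a' u = a u)"
  shows "(\<integral>u. data_gain S a r a' u \<partial>intensity_measure S a)
           + (\<integral>u. dummy_gain S a r a' u \<partial>intensity_measure S r) < 0"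
proof -
  let ?X = "\<lambda>u. indicator S u * a u * data_gain S a r a' u"
  let ?D = "\<lambda>u. indicator S u * r u * dummy_gain S a r a' u"
  have nonneg: "0 \<le> indicator S u * a u" "0 \<le> indicator S u * r u" for u
    using pos(1,3)[of u] by (auto simp: indicator_def)
  have [measurable]: "data_gain S a r a' \<in> borel_measurable borel" "dummy_gain S a r a' \<in> borel_measurable borel"
    using borel_measurable_integrable[OF data] borel_measurable_integrable[OF dummy] by simp_all
  have int: "integrable lborel ?X" "integrable lborel ?D"
    using data dummy nonneg by (simp_all add: intensity_measure_def integrable_density)
  have "(\<integral>u. data_gain S a r a' u \<partial>intensity_measure S a)
      + (\<integral>u. dummy_gain S a r a' u \<partial>intensity_measure S r) = (\<integral>u. ?X u \<partial>lborel) + (\<integral>u. ?D u \<partial>lborel)"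
    using nonneg by (simp add: intensity_measure_def integral_density)
  also have "\<dots> = - (\<integral>u. - (?X u + ?D u) \<partial>lborel)"
    using int by simp
  also have "\<dots> < 0"
  proof -
    have le: "0 \<le> - (?X u + ?D u)" for u
      using logistic_gain_nonpos[of "a u" "r u" "a' u"] pos[of u]
      by (auto simp: data_gain_def dummy_gain_def indicator_def)
    have "(\<integral>u. - (?X u + ?D u) \<partial>lborel) \<noteq> 0"
    proof
      assume "(\<integral>u. - (?X u + ?D u) \<partial>lborel) = 0"
      then have "AE u in lborel. - (?X u + ?D u) = 0"
        using integral_nonneg_eq_0_iff_AE[of lborel "\<lambda>u. - (?X u + ?D u)"] int le
        by (auto simp del: minus_add_distrib neg_0_le_iff_le neg_equal_0_iff_equal)
      then have "AE u in lborel. u \<in> S \<longrightarrow> a' u = a u"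
      proof eventually_elim
        case (elim u)
        show ?case
        proof
          assume u: "u \<in> S"
          show "a' u = a u"
            using elim u by (intro logistic_gain_eq_0D[of "a u" "r u" "a' u"] pos[OF u])
              (simp add: data_gain_def dummy_gain_def)
        qed
      qed
      with neq show False ..
    qed
    moreover have "0 \<le> (\<integral>u. - (?X u + ?D u) \<partial>lborel)"
      using le by (intro Bochner_Integration.integral_nonneg)
    ultimately show ?thesis by linarith
  qed
  finally show ?thesis .
qed

section \<open>Comparing parameters with the true one\<close>

text \<open>
  Consistency rests on the first moments of the processes, on the bound \<open>K\<close> for the covariates and
  on the log-linear form of the intensity.
\<close>

locale logistic_model = prob_space P for P :: "'w measure" +
  fixes S :: "'a::euclidean_space set" and Y E :: "nat \<Rightarrow> 'w \<Rightarrow> 'a multiset"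
    and b \<rho> :: "'a \<Rightarrow> real" and z :: "'a \<Rightarrow> real^'m" and \<theta>\<^sub>0 :: "real^'m" and K :: real
  assumes S: "S \<in> sets borel"
    and iid_Y: "iid_sequence P (configs S) Y" and iid_E: "iid_sequence P (configs S) E"
    and Y_intensity: "has_intensity P S (Y 0) (loglinear_intensity b z \<theta>\<^sub>0)"
    and E_intensity: "has_intensity P S (E 0) \<rho>"
    and b_pos: "\<And>u. u \<in> S \<Longrightarrow> 0 < b u" and rho_pos: "\<And>u. u \<in> S \<Longrightarrow> 0 < \<rho> u"
    and b_meas [measurable]: "b \<in> borel_measurable (restrict_space borel S)"
    and z_meas [measurable]: "z \<in> borel_measurable (restrict_space borel S)"
    and lam_int: "set_integrable lborel S (loglinear_intensity b z \<theta>\<^sub>0)"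
    and rho_int: "set_integrable lborel S \<rho>"
    and K_nonneg: "0 \<le> K" and norm_z_le: "\<And>u. u \<in> S \<Longrightarrow> norm (z u) \<le> K"
begin

abbreviation lam :: "real^'m \<Rightarrow> 'a \<Rightarrow> real" where
  "lam \<equiv> loglinear_intensity b z"

abbreviation loglik :: "nat \<Rightarrow> 'w \<Rightarrow> real^'m \<Rightarrow> real" where
  "loglik n \<omega> \<equiv> logistic_loglik lam \<rho> (superposition Y n \<omega>) (superposition E n \<omega>)"

abbreviation data_gain_at :: "real^'m \<Rightarrow> 'a \<Rightarrow> real" where
  "data_gain_at \<theta> \<equiv> data_gain S (lam \<theta>\<^sub>0) \<rho> (lam \<theta>)"

abbreviation dummy_gain_at :: "real^'m \<Rightarrow> 'a \<Rightarrow> real" where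
  "dummy_gain_at \<theta> \<equiv> dummy_gain S (lam \<theta>\<^sub>0) \<rho> (lam \<theta>)"

lemma lam_pos: "u \<in> S \<Longrightarrow> 0 < lam \<theta> u"
  using b_pos by (simp add: loglinear_intensity_pos)

lemma superposition_subset:
  assumes "\<omega> \<in> space P"
  shows "set_mset (superposition Y n \<omega>) \<subseteq> S" "set_mset (superposition E n \<omega>) \<subseteq> S"
proof -
  have "Y i \<in> measurable P (configs S)" "E i \<in> measurable P (configs S)" for i
    using iid_Y iid_E by (auto simp: iid_sequence_def indep_vars_def)
  from this[THEN measurable_space, OF assms]
  have "set_mset (Y i \<omega>) \<subseteq> S" "set_mset (E i \<omega>) \<subseteq> S" for i
    by (simp_all add: space_configs)
  then show "set_mset (superposition Y n \<omega>) \<subseteq> S" "set_mset (superposition E n \<omega>) \<subseteq> S"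
    by (simp_all add: set_mset_superposition_subset)
qed

lemma concave_loglik: "\<omega> \<in> space P \<Longrightarrow> concave_on UNIV (loglik n \<omega>)"
  using superposition_subset[of \<omega> n] b_pos rho_pos by (intro concave_logistic_loglik) auto

lemma loglik_diff_eq:
  assumes "\<omega> \<in> space P"
  shows "loglik n \<omega> \<theta> - loglik n \<omega> \<theta>\<^sub>0 =
    (\<Sum>x\<in>#superposition Y n \<omega>. data_gain_at \<theta> x) + (\<Sum>x\<in>#superposition E n \<omega>. dummy_gain_at \<theta> x)"
proof -
  note sub = superposition_subset[OF assms, of n]
  have "(\<Sum>x\<in>#superposition Y n \<omega>. data_gain_at \<theta> x) = (\<Sum>x\<in>#superposition Y n \<omega>.
      ln (lam \<theta> x / (lam \<theta> x + \<rho> x)) - ln (lam \<theta>\<^sub>0 x / (lam \<theta>\<^sub>0 x + \<rho> x)))"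
    using sub(1) by (intro arg_cong[of _ _ sum_mset] image_mset_cong) (auto simp: data_gain_def)
  moreover have "(\<Sum>x\<in>#superposition E n \<omega>. dummy_gain_at \<theta> x) = (\<Sum>x\<in>#superposition E n \<omega>.
      ln (\<rho> x / (lam \<theta> x + \<rho> x)) - ln (\<rho> x / (lam \<theta>\<^sub>0 x + \<rho> x)))"
    using sub(2) by (intro arg_cong[of _ _ sum_mset] image_mset_cong) (auto simp: dummy_gain_def)
  ultimately show ?thesis
    by (simp add: logistic_loglik_def sum_mset_diff)
qed

text \<open>
  Since the bounds do not depend on \<open>\<theta>'\<close>, one application of the law of large numbers to them serves
  a whole ball of parameters.
\<close>

lemma gain_le:
  assumes "dist \<theta> \<theta>' \<le> r"
  shows "data_gain_at \<theta>' u \<le> data_gain_at \<theta> u + K * r * indicator S u"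
    and "dummy_gain_at \<theta>' u \<le> dummy_gain_at \<theta> u + K * r * indicator S u"
proof -
  have "K * dist \<theta> \<theta>' \<le> K * r" using assms K_nonneg by (rule mult_left_mono)
  then show "data_gain_at \<theta>' u \<le> data_gain_at \<theta> u + K * r * indicator S u"
    and "dummy_gain_at \<theta>' u \<le> dummy_gain_at \<theta> u + K * r * indicator S u"
    using ln_type_prob_lipschitz[of b u \<rho> z K \<theta> \<theta>'] b_pos[of u] rho_pos[of u] norm_z_le[of u]
    by (cases "u \<in> S"; force simp: data_gain_def dummy_gain_def)+
qed

lemma borel_measurable_gain [measurable]:
  "data_gain_at \<theta> \<in> borel_measurable borel" "dummy_gain_at \<theta> \<in> borel_measurable borel"
proof -
  have rho_meas [measurable]: "\<rho> \<in> borel_measurable (restrict_space borel S)"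
    using E_intensity by (simp add: has_intensity_def)
  have lam_meas [measurable]: "lam \<theta> \<in> borel_measurable (restrict_space borel S)" for \<theta>
    unfolding loglinear_intensity_def[abs_def] by measurable
  have "(\<lambda>u. ln (lam \<theta> u / (lam \<theta> u + \<rho> u)) - ln (lam \<theta>\<^sub>0 u / (lam \<theta>\<^sub>0 u + \<rho> u)))
      \<in> borel_measurable (restrict_space borel S)" by measurable
  then show "data_gain_at \<theta> \<in> borel_measurable borel"
    using S by (simp add: borel_measurable_restrict_space_iff data_gain_def[abs_def])
  have "(\<lambda>u. ln (\<rho> u / (lam \<theta> u + \<rho> u)) - ln (\<rho> u / (lam \<theta>\<^sub>0 u + \<rho> u)))
      \<in> borel_measurable (restrict_space borel S)" by measurable
  then show "dummy_gain_at \<theta> \<in> borel_measurable borel"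
    using S by (simp add: borel_measurable_restrict_space_iff dummy_gain_def[abs_def])
qed

lemma integrable_bounded:
  fixes h :: "'a \<Rightarrow> real"
  assumes "h \<in> borel_measurable borel" "\<And>u. \<bar>h u\<bar> \<le> C"
  shows "integrable (intensity_measure S (lam \<theta>\<^sub>0)) h" "integrable (intensity_measure S \<rho>) h"
proof -
  show "integrable (intensity_measure S (lam \<theta>\<^sub>0)) h"
    by (rule integrable_intensity_measure_bounded[OF lam_int _ assms]) (simp add: lam_pos less_imp_le)
  show "integrable (intensity_measure S \<rho>) h"
    by (rule integrable_intensity_measure_bounded[OF rho_int _ assms]) (simp add: rho_pos less_imp_le)
qed

lemma integrable_gain:
  "integrable (intensity_measure S (lam \<theta>\<^sub>0)) (data_gain_at \<theta>)"
  "integrable (intensity_measure S \<rho>) (dummy_gain_at \<theta>)"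
proof -
  have "\<bar>data_gain_at \<theta> u\<bar> \<le> K * dist \<theta> \<theta>\<^sub>0" "\<bar>dummy_gain_at \<theta> u\<bar> \<le> K * dist \<theta> \<theta>\<^sub>0" for u
    using ln_type_prob_lipschitz[of b u \<rho> z K \<theta> \<theta>\<^sub>0] b_pos[of u] rho_pos[of u] norm_z_le[of u] K_nonneg
    by (cases "u \<in> S"; force simp: data_gain_def dummy_gain_def)+
  then show "integrable (intensity_measure S (lam \<theta>\<^sub>0)) (data_gain_at \<theta>)"
    "integrable (intensity_measure S \<rho>) (dummy_gain_at \<theta>)"
    by (auto intro: integrable_bounded borel_measurable_gain)
qed

text \<open>
  The mean gain \<open>m\<close> at \<open>\<theta>\<close> is negative and \<open>N\<close> is the mean number of points of \<open>Y 0\<close> and \<open>E 0\<close>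
  together, so the radius is taken so small that \<open>m + K r N < 0\<close>.  The gains at all \<open>\<theta>'\<close> in the
  ball are then dominated by sums whose mean per step is negative.  Data and dummy points are
  treated separately, with thresholds \<open>c\<close> and \<open>- c\<close> per step.
\<close>

lemma AE_loglik_less_locally:
  assumes neq: "\<not> (AE u in lborel. u \<in> S \<longrightarrow> lam \<theta> u = lam \<theta>\<^sub>0 u)"
  obtains r where "0 < r"
    "AE \<omega> in P. \<forall>\<^sub>F n in sequentially. \<forall>\<theta>'\<in>ball \<theta> r. loglik n \<omega> \<theta>' < loglik n \<omega> \<theta>\<^sub>0"
proof -
  let ?\<nu>Y = "intensity_measure S (lam \<theta>\<^sub>0)" and ?\<nu>E = "intensity_measure S \<rho>"
  define m where "m = (\<integral>u. data_gain_at \<theta> u \<partial>?\<nu>Y) + (\<integral>u. dummy_gain_at \<theta> u \<partial>?\<nu>E)"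
  define N where "N = (\<integral>u. indicator S u \<partial>?\<nu>Y) + (\<integral>u. indicator S u \<partial>?\<nu>E :: real)"
  have m: "m < 0"
    unfolding m_def using neq lam_pos rho_pos has_intensity_measurable[OF Y_intensity S]
      has_intensity_measurable[OF E_intensity S] integrable_gain
    by (intro expected_gain_neg) auto
  have ind: "integrable ?\<nu>Y (indicator S :: _ \<Rightarrow> real)" "integrable ?\<nu>E (indicator S :: _ \<Rightarrow> real)"
    using S by (auto intro!: integrable_bounded[where C=1] simp: indicator_def)
  have N: "0 \<le> N"
    unfolding N_def by (intro add_nonneg_nonneg Bochner_Integration.integral_nonneg) auto
  define r where "r = - m / (K * N + 1)"
  have KN: "0 \<le> K * N" using K_nonneg N by simp
  then have r: "0 < r" "m + K * r * N < 0"
    using m by (auto simp: r_def divide_simps)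
  define hY where "hY u = data_gain_at \<theta> u + K * r * indicator S u" for u
  define hE where "hE u = dummy_gain_at \<theta> u + K * r * indicator S u" for u
  have h_int: "integrable ?\<nu>Y hY" "integrable ?\<nu>E hE"
    unfolding hY_def[abs_def] hE_def[abs_def] using integrable_gain ind by auto
  have "(\<integral>u. hY u \<partial>?\<nu>Y) + (\<integral>u. hE u \<partial>?\<nu>E) = m + K * r * N"
    unfolding hY_def hE_def m_def N_def using integrable_gain ind by (simp add: algebra_simps)
  with r have "(\<integral>u. hY u \<partial>?\<nu>Y) < - (\<integral>u. hE u \<partial>?\<nu>E)" by simp
  then obtain c where c: "(\<integral>u. hY u \<partial>?\<nu>Y) < c" "(\<integral>u. hE u \<partial>?\<nu>E) < - c"
    using dense[of "\<integral>u. hY u \<partial>?\<nu>Y" "- (\<integral>u. hE u \<partial>?\<nu>E)"] by (auto simp: less_minus_iff)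
  have "AE \<omega> in P. \<forall>\<^sub>F n in sequentially. \<forall>\<theta>'\<in>ball \<theta> r. loglik n \<omega> \<theta>' < loglik n \<omega> \<theta>\<^sub>0"
    using AE_eventually_superposition_less[OF S iid_Y Y_intensity h_int(1) c(1)]
      AE_eventually_superposition_less[OF S iid_E E_intensity h_int(2) c(2)] AE_space
  proof eventually_elim
    case (elim \<omega>)
    from elim(1,2) show ?case
    proof eventually_elim
      case (elim n)
      show ?case
      proof
        fix \<theta>' assume "\<theta>' \<in> ball \<theta> r"
        then have "dist \<theta> \<theta>' \<le> r" by simp
        from gain_le[OF this]
        have "(\<Sum>x\<in>#superposition Y n \<omega>. data_gain_at \<theta>' x) \<le> (\<Sum>x\<in>#superposition Y n \<omega>. hY x)"
          "(\<Sum>x\<in>#superposition E n \<omega>. dummy_gain_at \<theta>' x) \<le> (\<Sum>x\<in>#superposition E n \<omega>. hE x)"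
          unfolding hY_def hE_def by (intro sum_mset_mono; simp)+
        with elim loglik_diff_eq[OF \<open>\<omega> \<in> space P\<close>, of n \<theta>']
        show "loglik n \<omega> \<theta>' < loglik n \<omega> \<theta>\<^sub>0" by simp
      qed
    qed
  qed
  with r(1) show ?thesis by (rule that)
qed

lemma AE_loglik_less_on_compact:
  assumes "compact C" and neq: "\<And>\<theta>. \<theta> \<in> C \<Longrightarrow> \<not> (AE u in lborel. u \<in> S \<longrightarrow> lam \<theta> u = lam \<theta>\<^sub>0 u)"
  shows "AE \<omega> in P. \<forall>\<^sub>F n in sequentially. \<forall>\<theta>\<in>C. loglik n \<omega> \<theta> < loglik n \<omega> \<theta>\<^sub>0"
proof -
  let ?less = "\<lambda>\<theta> r. AE \<omega> in P. \<forall>\<^sub>F n in sequentially. \<forall>\<theta>'\<in>ball \<theta> r. loglik n \<omega> \<theta>' < loglik n \<omega> \<theta>\<^sub>0"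
  have "\<forall>\<theta>\<in>C. \<exists>r. 0 < r \<and> ?less \<theta> r"
  proof
    fix \<theta> assume "\<theta> \<in> C"
    from neq[OF this] show "\<exists>r. 0 < r \<and> ?less \<theta> r"
      by (rule AE_loglik_less_locally) (intro exI conjI)
  qed
  from bchoice[OF this] obtain r where "\<forall>\<theta>\<in>C. 0 < r \<theta> \<and> ?less \<theta> (r \<theta>)" ..
  then have r: "\<And>\<theta>. \<theta> \<in> C \<Longrightarrow> 0 < r \<theta>" "\<And>\<theta>. \<theta> \<in> C \<Longrightarrow> ?less \<theta> (r \<theta>)"
    by simp_all
  have "C \<subseteq> (\<Union>\<theta>\<in>C. ball \<theta> (r \<theta>))"
    using r(1) by (meson UN_I centre_in_ball subsetI)
  then obtain F where F: "F \<subseteq> C" "finite F" "C \<subseteq> (\<Union>\<theta>\<in>F. ball \<theta> (r \<theta>))"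
    by (rule compactE_image[OF \<open>compact C\<close> open_ball])
  have "AE \<omega> in P. \<forall>\<theta>\<in>F. \<forall>\<^sub>F n in sequentially. \<forall>\<theta>'\<in>ball \<theta> (r \<theta>). loglik n \<omega> \<theta>' < loglik n \<omega> \<theta>\<^sub>0"
    by (rule AE_finite_allI[OF F(2) r(2)]) (use F(1) in blast)
  then show ?thesis
  proof eventually_elim
    case (elim \<omega>)
    then have "\<forall>\<^sub>F n in sequentially. \<forall>\<theta>\<in>F. \<forall>\<theta>'\<in>ball \<theta> (r \<theta>). loglik n \<omega> \<theta>' < loglik n \<omega> \<theta>\<^sub>0"
      by (rule eventually_ball_finite[OF F(2)])
    then show ?case
      by eventually_elim (use F(3) in blast)
  qed
qed

end

section \<open>Strong consistency\<close>

theorem theorem3p3: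
  fixes W :: "(real^2) set" and T :: "real set"
    and P :: "'w measure"
    and Y E :: "nat \<Rightarrow> 'w \<Rightarrow> ((real^2) \<times> real) multiset"
    and b \<rho> :: "(real^2) \<times> real \<Rightarrow> real"
    and z :: "(real^2) \<times> real \<Rightarrow> real^'m"
    and Th :: "(real^'m) set" and \<theta>\<^sub>0 :: "real^'m"
    and \<theta>hat :: "nat \<Rightarrow> 'w \<Rightarrow> real^'m"
  defines "lam \<equiv> loglinear_intensity b z"
  defines "l \<equiv> (\<lambda>n \<omega>. logistic_loglik lam \<rho> (superposition Y n \<omega>) (superposition E n \<omega>))"
  defines "attained \<equiv> (\<lambda>n \<omega>. \<exists>\<theta>. is_arg_max (l n \<omega>) (\<lambda>\<theta>. \<theta> \<in> Th) \<theta>)"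
  assumes region: "open (W \<times> T)" "bounded (W \<times> T)" "W \<times> T \<noteq> {}"
    and prob: "prob_space P"
    and iid_Y: "iid_sequence P (configs (W \<times> T)) Y"
    and iid_E: "iid_sequence P (configs (W \<times> T)) E"
    and indep: "indep_sequences P (configs (W \<times> T)) Y E"
    and b_pos: "\<And>u. u \<in> W \<times> T \<Longrightarrow> 0 < b u"
    and b_int: "set_integrable lborel (W \<times> T) b"
    and z_meas: "z \<in> borel_measurable (restrict_space borel (W \<times> T))"
    and Th_open: "open Th"
    and true_param: "\<theta>\<^sub>0 \<in> Th"
    and Y_poisson: "\<And>i. poisson_process P (W \<times> T) (Y i) (lam \<theta>\<^sub>0)"
    and E_intensity: "\<And>i. has_intensity P (W \<times> T) (E i) \<rho>"
    and rho_pos: "\<And>u. u \<in> W \<times> T \<Longrightarrow> 0 < \<rho> u"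
    and rho_int: "set_integrable lborel (W \<times> T) \<rho>"
    and ratio: "\<And>\<theta>. \<theta> \<in> Th \<Longrightarrow> \<exists>\<epsilon>\<^sub>1>0. \<exists>\<epsilon>\<^sub>2>0.
        ereal \<epsilon>\<^sub>1 < (INF u\<in>W \<times> T. ereal (\<rho> u / lam \<theta> u)) \<and>
        (SUP u\<in>W \<times> T. ereal (\<rho> u / lam \<theta> u)) < ereal \<epsilon>\<^sub>2"
    and z_bounded: "(SUP u\<in>W \<times> T. ereal (norm (z u))) < \<infinity>"
    and Th_convex: "convex Th"
    and identifiable: "\<And>\<theta> \<theta>'. \<theta> \<in> Th \<Longrightarrow> \<theta>' \<in> Th \<Longrightarrow>
        (AE u in lborel. u \<in> W \<times> T \<longrightarrow> lam \<theta> u = lam \<theta>' u) \<Longrightarrow> \<theta> = \<theta>'"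
    and estimator: "\<And>n \<omega>. \<omega> \<in> space P \<Longrightarrow> attained n \<omega> \<Longrightarrow>
        is_arg_max (l n \<omega>) (\<lambda>\<theta>. \<theta> \<in> Th) (\<theta>hat n \<omega>)"
  shows "AE \<omega> in P. ((\<lambda>n. \<theta>hat n \<omega>) \<longlongrightarrow> \<theta>\<^sub>0)
           (inf sequentially (principal {n. attained n \<omega>}))"
proof -
  interpret prob_space P by fact
  let ?S = "W \<times> T"
  have S: "?S \<in> sets borel" using region(1) by simp
  obtain K :: nat where K: "(SUP u\<in>?S. ereal (norm (z u))) < ereal (real K)"
    using z_bounded less_PInf_Ex_of_nat by auto
  have K: "norm (z u) \<le> real K" if "u \<in> ?S" for u
    using SUP_upper[OF that, of "\<lambda>u. ereal (norm (z u))"] K by (metis ereal_less_eq(3) le_less_trans less_imp_le)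
  have lam_eq: "loglinear_intensity b z = lam" by (simp add: lam_def)
  interpret logistic_model P ?S Y E b \<rho> z \<theta>\<^sub>0 "real K"
  proof (unfold_locales, unfold lam_eq)
    show "has_intensity P ?S (Y 0) (lam \<theta>\<^sub>0)"
      by (rule poisson_process_has_intensity[OF prob S Y_poisson])
    show "b \<in> borel_measurable (restrict_space borel ?S)"
      using b_int S borel_measurable_restrict_space_iff[of ?S borel b]
      by (auto simp: set_integrable_def dest: borel_measurable_integrable)
    show "set_integrable lborel ?S (lam \<theta>\<^sub>0)"
      using Y_poisson[of 0] by (simp add: poisson_process_def)
  qed (use S iid_Y iid_E E_intensity b_pos rho_pos z_meas rho_int K in auto)
  have l_eq: "l n \<omega> = loglik n \<omega>" for n \<omega>
    by (simp add: l_def lam_def)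
  obtain e where e: "0 < e" "cball \<theta>\<^sub>0 e \<subseteq> Th"
    using Th_open true_param open_contains_cball by blast
  define \<epsilon> where "\<epsilon> k = e / real (Suc k)" for k
  have \<epsilon>: "0 < \<epsilon> k" "sphere \<theta>\<^sub>0 (\<epsilon> k) \<subseteq> Th - {\<theta>\<^sub>0}" for k
  proof -
    show "0 < \<epsilon> k" using e by (simp add: \<epsilon>_def)
    moreover have "\<epsilon> k \<le> e" using e by (simp add: \<epsilon>_def divide_le_eq)
    ultimately show "sphere \<theta>\<^sub>0 (\<epsilon> k) \<subseteq> Th - {\<theta>\<^sub>0}" using e(2) by auto
  qed
  \<comment> \<open>Countably many radii keep the exceptional event null.\<close>
  have "AE \<omega> in P. \<forall>\<^sub>F n in sequentially. \<forall>\<theta>\<in>sphere \<theta>\<^sub>0 (\<epsilon> k). loglik n \<omega> \<theta> < loglik n \<omega> \<theta>\<^sub>0" for k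
  proof (rule AE_loglik_less_on_compact[OF compact_sphere])
    fix \<theta> assume "\<theta> \<in> sphere \<theta>\<^sub>0 (\<epsilon> k)"
    with \<epsilon>(2)[of k] have "\<theta> \<in> Th" "\<theta> \<noteq> \<theta>\<^sub>0" by auto
    with identifiable[of \<theta> \<theta>\<^sub>0] true_param
    show "\<not> (AE u in lborel. u \<in> ?S \<longrightarrow> loglinear_intensity b z \<theta> u = loglinear_intensity b z \<theta>\<^sub>0 u)"
      unfolding lam_def by blast
  qed
  then have "AE \<omega> in P. \<forall>k. \<forall>\<^sub>F n in sequentially. \<forall>\<theta>\<in>sphere \<theta>\<^sub>0 (\<epsilon> k). loglik n \<omega> \<theta> < loglik n \<omega> \<theta>\<^sub>0"
    by (simp add: AE_all_countable)
  with AE_space show ?thesis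
  proof eventually_elim
    case (elim \<omega>)
    show ?case
    proof (rule tendstoI)
      fix d :: real assume "0 < d"
      obtain k where "e / d < real k" using reals_Archimedean2 by blast
      then have "e / d < real (Suc k)" by simp
      then have k: "\<epsilon> k < d" using \<open>0 < d\<close> by (simp add: \<epsilon>_def field_simps)
      have "\<forall>\<^sub>F n in sequentially. \<forall>\<theta>\<in>sphere \<theta>\<^sub>0 (\<epsilon> k). loglik n \<omega> \<theta> < loglik n \<omega> \<theta>\<^sub>0"
        using elim by blast
      then have "\<forall>\<^sub>F n in sequentially. attained n \<omega> \<longrightarrow> dist (\<theta>hat n \<omega>) \<theta>\<^sub>0 < d"
      proof eventually_elim
        case (elim n)
        show ?case
        proof
          assume "attained n \<omega>"
          from estimator[OF \<open>\<omega> \<in> space P\<close> this] true_param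
          have "loglik n \<omega> \<theta>\<^sub>0 \<le> loglik n \<omega> (\<theta>hat n \<omega>)"
            by (auto simp: is_arg_max_def l_eq not_less)
          then have "dist (\<theta>hat n \<omega>) \<theta>\<^sub>0 < \<epsilon> k"
            using elim by (intro concave_superlevel_in_ball[OF concave_loglik[OF \<open>\<omega> \<in> space P\<close>] \<epsilon>(1)])
              (auto simp: dist_commute)
          with k show "dist (\<theta>hat n \<omega>) \<theta>\<^sub>0 < d" by simp
        qed
      qed
      then show "\<forall>\<^sub>F n in inf sequentially (principal {n. attained n \<omega>}). dist (\<theta>hat n \<omega>) \<theta>\<^sub>0 < d"
        by (simp add: eventually_inf_principal)
    qed
  qed
qed

end
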